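(* Let $V$ be a vector space equipped with an injective linear map $Y(\cdot,x):V\to(\mathrm{End}\,V)[[x,x^{-1}]]$, $v\mapsto Y(v,x)=\sum_{n\in\mathbb Z}v_nx^{-n-1}$, such that $Y(u,x)v\in V((x))$ for all $u,v\in V$. Then weak skew-associativity together with vacuum-free skew-symmetry can replace the Jacobi identity in the definition of vacuum-free vertex algebra; that is, the Jacobi identity $$x_0^{-1}\delta\left(\frac{x_1-x_2}{x_0}\right)Y(u,x_1)Y(v,x_2)-x_0^{-1}\delta\left(\frac{-x_2+x_1}{x_0}\right)Y(v,x_2)Y(u,x_1)=x_1^{-1}\delta\left(\frac{x_2+x_0}{x_1}\right)Y(Y(u,x_0)v,x_2)$$ holds for all $u,v\in V$ if and only if both of the following hold: (weak skew-associativity) for all $u,v,w\in V$ there exists an integer $m\ge0$ such that $(x_1-x_0)^{m}\left(Y(v,-x_0+x_1)Y(u,x_1)w-Y(Y(u,x_0)v,x_1-x_0)w\right)=0$; (vacuum-free skew-symmetry) for all $u,v\in V$, $Y(Y(u,x_0)v,x_2)=Y(Y(v,-x_0)u,x_2+x_0)$.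
   Context: All vector spaces are over $\mathbb C$; formal variables commute. For a vector space $U$, $U[[x,x^{-1}]]$ is the space of all formal Laurent series $\sum_{n\in\mathbb Z}u_nx^n$ with $u_n\in U$; $U((x))$ is the subspace of series with $u_n=0$ for $n$ sufficiently negative. $\delta(x)=\sum_{n\in\mathbb Z}x^n$. Binomial expansion convention: for every $n\in\mathbb Z$, $(x+y)^n=\sum_{k\ge0}\binom nk x^{n-k}y^k$, i.e. binomials are expanded in nonnegative powers of the second-listed variable (likewise with signs, so $(x_1-x_2)^n$ is expanded in nonnegative powers of $x_2$ and $(-x_2+x_1)^n$ in nonnegative powers of $x_1$); this applies inside $\delta$ and to substitutions such as $F(x+y)$. The map $Y$ is extended coefficientwise to series: $Y(Y(u,x_0)v,x_2)=\sum_n Y(u_nv,x_2)x_0^{-n-1}$. A vacuum-free vertex algebra is a vector space $V$ with an injective linear map $Y(\cdot,x):V\to(\mathrm{End}\,V)[[x,x^{-1}]]$ such that $Y(u,x)v\in V((x))$ for all $u,v\in V$ and the Jacobi identity (displayed in the claim) holds for all $u,v\in V$. *)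

theory Defs
  imports Complex_Main "HOL-Library.Poly_Mapping"
begin

section \<open>Formal series\<close>

text \<open>
  A series in the commuting variables $x_0, x_1, x_2$ is given by its coefficients, with no
  restriction on the support; an exponent is a finitely supported map from variables to integers.
  Since \<^const>\<open>Sum_any\<close> is 0 on infinite supports, the operations below are meaningful only when
  each coefficient is a sum with finitely many nonzero terms. By linearity of $Y$ and
  $Y(u,x)v \in V((x))$ this is the case in all expressions used here.
\<close>

datatype fvar = X0 | X1 | X2

type_synonym 'a fseries = "(fvar \<Rightarrow>\<^sub>0 int) \<Rightarrow> 'a"

definition fconst :: "'a::zero \<Rightarrow> 'a fseries" where
  "fconst a = (\<lambda>e. a when e = 0)"

text \<open>Product of a scalar series with a series with coefficients in a vector space
  (or, for scale = (*), with another scalar series).\<close>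

definition fmult :: "(complex \<Rightarrow> 'v \<Rightarrow> 'v) \<Rightarrow> complex fseries \<Rightarrow> 'v fseries \<Rightarrow> 'v::comm_monoid_add fseries" where
  "fmult scale f G = (\<lambda>e. Sum_any (\<lambda>d. scale (f d) (G (e - d))))"

text \<open>What is substituted for a formal variable is represented by the sequence of its integer powers.
  \<open>mono_pow c x n\<close> is $(cx)^n$, and \<open>binom_pow c x d y n\<close> is $(cx+dy)^n$ expanded in nonnegative
  powers of the second-listed variable $y$.\<close>

definition mono_pow :: "complex \<Rightarrow> fvar \<Rightarrow> int \<Rightarrow> complex fseries" where
  "mono_pow c x n = (\<lambda>e. c powi n when e = Poly_Mapping.single x n)"

definition binom_pow :: "complex \<Rightarrow> fvar \<Rightarrow> complex \<Rightarrow> fvar \<Rightarrow> int \<Rightarrow> complex fseries" where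
  "binom_pow c x d y n = (\<lambda>e. Sum_any (\<lambda>k::nat.
     (of_int n gchoose k) * c powi (n - int k) * d ^ k
       when e = Poly_Mapping.single x (n - int k) + Poly_Mapping.single y (int k)))"

text \<open>$\delta(Q)=\sum_{n\in\mathbb Z} Q^n$, and $z^{-1}\delta(P/z)$ where $(P/z)^n = P^n z^{-n}$.\<close>

definition fdelta :: "(int \<Rightarrow> complex fseries) \<Rightarrow> complex fseries" where
  "fdelta Q = (\<lambda>e. Sum_any (\<lambda>n. Q n e))"

definition delta_quot :: "(int \<Rightarrow> complex fseries) \<Rightarrow> fvar \<Rightarrow> complex fseries" where
  "delta_quot P z =
     fmult (*) (mono_pow 1 z (-1)) (fdelta (\<lambda>n. fmult (*) (P n) (mono_pow 1 z (-n))))"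


section \<open>Vertex operators\<close>

text \<open>\<open>Y v n w\<close> is $v_n w$, where $Y(v,x)=\sum_n v_n x^{-n-1}$.\<close>

definition vertex_operator_map ::
  "(complex \<Rightarrow> 'v \<Rightarrow> 'v) \<Rightarrow> ('v \<Rightarrow> int \<Rightarrow> 'v \<Rightarrow> 'v::ab_group_add) \<Rightarrow> bool" where
  "vertex_operator_map scale Y \<longleftrightarrow>
     (\<forall>v n. Vector_Spaces.linear scale scale (Y v n)) \<and>
     (\<forall>n w. Vector_Spaces.linear scale scale (\<lambda>v. Y v n w)) \<and>
     inj Y \<and>
     (\<forall>u v. \<exists>N. \<forall>n\<ge>N. Y u n v = 0)"

text \<open>\<open>vop scale Y G P F\<close> is $Y(G,P)F = \sum_n G_n F \, P^{-n-1}$, where $Y$ is extended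
  coefficientwise to vector-valued series $G$ and $F$.
  Identities between operator-valued series are stated after applying them to a vector $w$.\<close>

definition vop ::
  "(complex \<Rightarrow> 'v \<Rightarrow> 'v) \<Rightarrow> ('v \<Rightarrow> int \<Rightarrow> 'v \<Rightarrow> 'v) \<Rightarrow>
   'v fseries \<Rightarrow> (int \<Rightarrow> complex fseries) \<Rightarrow> 'v fseries \<Rightarrow> 'v::comm_monoid_add fseries" where
  "vop scale Y G P F =
     (\<lambda>e. Sum_any (\<lambda>(a, n, b). scale (P (- n - 1) b) (Y (G a) n (F (e - a - b)))))"

definition jacobi_identity ::
  "(complex \<Rightarrow> 'v \<Rightarrow> 'v) \<Rightarrow> ('v \<Rightarrow> int \<Rightarrow> 'v \<Rightarrow> 'v::ab_group_add) \<Rightarrow> 'v \<Rightarrow> 'v \<Rightarrow> bool" where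
  "jacobi_identity scale Y u v \<longleftrightarrow> (\<forall>w.
     (\<lambda>e. fmult scale (delta_quot (binom_pow 1 X1 (-1) X2) X0)
            (vop scale Y (fconst u) (mono_pow 1 X1)
              (vop scale Y (fconst v) (mono_pow 1 X2) (fconst w))) e
        - fmult scale (delta_quot (binom_pow (-1) X2 1 X1) X0)
            (vop scale Y (fconst v) (mono_pow 1 X2)
              (vop scale Y (fconst u) (mono_pow 1 X1) (fconst w))) e)
     = fmult scale (delta_quot (binom_pow 1 X2 1 X0) X1)
         (vop scale Y (vop scale Y (fconst u) (mono_pow 1 X0) (fconst v)) (mono_pow 1 X2)
           (fconst w)))"

definition weak_skew_associativity ::
  "(complex \<Rightarrow> 'v \<Rightarrow> 'v) \<Rightarrow> ('v \<Rightarrow> int \<Rightarrow> 'v \<Rightarrow> 'v::ab_group_add) \<Rightarrow> 'v \<Rightarrow> 'v \<Rightarrow> 'v \<Rightarrow> bool" where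
  "weak_skew_associativity scale Y u v w \<longleftrightarrow> (\<exists>m::int. m \<ge> 0 \<and>
     fmult scale (binom_pow 1 X1 (-1) X0 m)
       (\<lambda>e. vop scale Y (fconst v) (binom_pow (-1) X0 1 X1)
              (vop scale Y (fconst u) (mono_pow 1 X1) (fconst w)) e
          - vop scale Y (vop scale Y (fconst u) (mono_pow 1 X0) (fconst v))
              (binom_pow 1 X1 (-1) X0) (fconst w) e)
     = (\<lambda>e. 0))"

definition vacuum_free_skew_symmetry ::
  "(complex \<Rightarrow> 'v \<Rightarrow> 'v) \<Rightarrow> ('v \<Rightarrow> int \<Rightarrow> 'v \<Rightarrow> 'v::ab_group_add) \<Rightarrow> 'v \<Rightarrow> 'v \<Rightarrow> bool" where
  "vacuum_free_skew_symmetry scale Y u v \<longleftrightarrow> (\<forall>w.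
     vop scale Y (vop scale Y (fconst u) (mono_pow 1 X0) (fconst v)) (mono_pow 1 X2) (fconst w)
     = vop scale Y (vop scale Y (fconst v) (mono_pow (-1) X0) (fconst u))
         (binom_pow 1 X2 1 X0) (fconst w))"

end

theory Submission
  imports Defs
begin

text \<open>
  Fix $u,v,w$ and compare coefficients of $x_0^{-l-1}x_1^{-m-1}x_2^{-n-1}$. The Jacobi identity becomes
  $J(l,m,n)=0$ for all integers $l,m,n$, where $J=T_{u,v}-T_{v,u}^\ast-R_{u,v}$ with
  \[ T_{u,v}(l,m,n)=\sum_{k\ge0}(-1)^k\binom lk u_{m+l-k}v_{n+k}w,\qquad
     R_{u,v}(l,m,n)=\sum_{k\ge0}\binom mk (u_{l+k}v)_{m+n-k}w, \]
  and $F^\ast(l,m,n)=(-1)^lF(l,n,m)$. By Pascal's rule each of these sequences satisfies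
  \[ F(l+1,m,n)=F(l,m+1,n)-F(l,m,n+1), \]
  and the proof consists in exploiting this one recursion.

  Put $S=T_{v,u}^\ast+R_{u,v}$. Weak skew-associativity says that for some $N$ the plane $n=N$ of $S$ vanishes,
  because multiplication by $(x_1-x_0)^N$ shifts $n$ from $0$ to $N$
  (\<open>triangular_binsum\<close>, \<open>weak_skew_associativity_iff\<close>). Skew-symmetry says that
  $R_{u,v}=-R_{v,u}^\ast$ on the plane $m=0$ (\<open>vacuum_free_skew_symmetry_iff\<close>). Both follow from $J=0$:
  truncation gives $T_{u,v}=0$ for large $n$, and in $J_{u,v}+J_{v,u}^\ast$ the products cancel.

  For the converse, the recursion extends $R_{u,v}=-R_{v,u}^\ast$ to all $m$ (\<open>iterate_skew\<close>), whence
  $J_{u,v}=-J_{v,u}^\ast$. Weak skew-associativity and truncation give $J_{u,v}(l,m,n)=0$ for $n$ large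
  and arbitrary $l,m$; the symmetry gives the same for $m$ large. So $J$ vanishes where $m+n$ is
  large, and the recursion, which expresses $J(l+1,m,n)$ by values with $m+n$ one larger, propagates
  the vanishing to all of the lattice (\<open>triangular_zero\<close>).
\<close>

section \<open>Sums and signs\<close>

text \<open>
  Reindexing holds without any finiteness condition, since \<open>Sum_any\<close> is 0 on both sides when
  the support is infinite. It lets every coefficient of a product be read off before finiteness
  is considered.
\<close>

lemma Sum_any_reindex_support:
  assumes "inj g" and "\<And>x. f x \<noteq> 0 \<Longrightarrow> x \<in> range g"
  shows "Sum_any f = Sum_any (\<lambda>i. f (g i))"
proof -
  have eq: "{x. f x \<noteq> 0} = g ` {i. f (g i) \<noteq> 0}"
    using assms(2) by auto
  have "sum f {x. f x \<noteq> 0} = sum (\<lambda>i. f (g i)) {i. f (g i) \<noteq> 0}"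
    unfolding eq by (subst sum.reindex) (use assms(1) in \<open>auto simp: inj_on_def\<close>)
  then show ?thesis by (simp add: Sum_any.expand_set)
qed

lemma Sum_any_single_support:
  assumes "\<And>x. x \<noteq> i \<Longrightarrow> f x = 0"
  shows "Sum_any f = f i"
proof -
  have "Sum_any f = sum f {i}"
    using assms by (intro Sum_any.expand_superset) auto
  then show ?thesis by simp
qed

lemma gchoose_negated_upper:
  "(of_int (- l - 1 + int k) gchoose k :: complex) = (-1) ^ k * (of_int l gchoose k)"
  by (subst gbinomial_negated_upper) simp

lemma minus_one_powi_diff: "((-1) powi (l - int k) :: complex) = (-1) powi l * (-1) ^ k"
  by (cases "even k") (simp_all add: power_int_diff)

lemma minus_one_powi_square: "(-1) powi l * (-1) powi l = (1::complex)"
  by (simp add: power_int_mult_distrib[symmetric])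

lemma minus_one_powi_reflect: "(-1) powi (- l - 1) = - ((-1) powi l :: complex)"
  using inverse_unique[OF minus_one_powi_square] by (simp add: power_int_diff power_int_minus)

section \<open>Products with binomial and delta series\<close>

text \<open>
  The exponents that occur in $(cx+dy)^n$, indexed by the power $k$ of $y$. For distinct $x$ and $y$
  this indexing is injective, so a sum over exponents becomes a sum over $k$.
\<close>

definition binom_exp :: "fvar \<Rightarrow> fvar \<Rightarrow> int \<Rightarrow> nat \<Rightarrow> (fvar \<Rightarrow>\<^sub>0 int)" where
  "binom_exp x y n k = Poly_Mapping.single x (n - int k) + Poly_Mapping.single y (int k)"

lemma lookup_binom_exp [simp]:
  "x \<noteq> y \<Longrightarrow> Poly_Mapping.lookup (binom_exp x y n k) z =
     (if z = x then n - int k else if z = y then int k else 0)"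
  by (auto simp: binom_exp_def lookup_add lookup_single)

lemma binom_exp_inject: "x \<noteq> y \<Longrightarrow> binom_exp x y n k = binom_exp x y n k' \<longleftrightarrow> k = k'"
  by (metis lookup_binom_exp of_nat_eq_iff)

lemma binom_pow_binom_exp:
  assumes "x \<noteq> y"
  shows "binom_pow c x d y n (binom_exp x y n k) = (of_int n gchoose k) * c powi (n - int k) * d ^ k"
  unfolding binom_pow_def binom_exp_def[symmetric]
  by (subst Sum_any_single_support[of k]) (auto simp: binom_exp_inject assms)

lemma binom_pow_nonzeroD:
  assumes "binom_pow c x d y n e \<noteq> 0"
  shows "e \<in> range (binom_exp x y n)"
proof (rule ccontr)
  assume "e \<notin> range (binom_exp x y n)"
  then have "e \<noteq> binom_exp x y n k" for k by blast
  then have "binom_pow c x d y n e = 0"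
    unfolding binom_pow_def binom_exp_def[symmetric] by simp
  with assms show False by simp
qed

text \<open>
  If no $P^n$ involves $z$, the exponent of $z$ in $z^{-1}\delta(P/z)=\sum_n P^n z^{-n-1}$ determines
  $n$, so a single summand contributes to each coefficient.
\<close>

lemma delta_quot_apply:
  assumes "\<And>n d. P n d \<noteq> 0 \<Longrightarrow> Poly_Mapping.lookup d z = 0"
  shows "delta_quot P z e =
    P (- Poly_Mapping.lookup e z - 1) (e - Poly_Mapping.single z (Poly_Mapping.lookup e z))"
proof -
  let ?n = "- Poly_Mapping.lookup e z - 1"
  have shift: "fmult (*) (P n) (mono_pow 1 z (-n)) d = P n (d + Poly_Mapping.single z n)" for n d
  proof -
    have iff: "d - d' = Poly_Mapping.single z (- n) \<longleftrightarrow> d' = d + Poly_Mapping.single z n" for d'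
    proof
      assume "d - d' = Poly_Mapping.single z (- n)"
      then have "d - (d - d') = d + Poly_Mapping.single z n" by (simp only: single_uminus diff_minus_eq_add)
      then show "d' = d + Poly_Mapping.single z n" by simp
    qed (simp add: single_uminus)
    show ?thesis
      unfolding fmult_def mono_pow_def iff
      by (subst Sum_any_single_support[of "d + Poly_Mapping.single z n"]) simp_all
  qed
  have "delta_quot P z e = fdelta (\<lambda>n. fmult (*) (P n) (mono_pow 1 z (-n))) (e + Poly_Mapping.single z 1)"
    unfolding delta_quot_def fmult_def[where G = "fdelta _"] mono_pow_def[of _ _ "-1"]
    by (subst Sum_any_single_support[of "Poly_Mapping.single z (- 1)"]) (auto simp: single_uminus)
  also have "\<dots> = Sum_any (\<lambda>n. P n (e + Poly_Mapping.single z 1 + Poly_Mapping.single z n))"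
    by (simp add: fdelta_def shift)
  also have "\<dots> = P ?n (e + Poly_Mapping.single z 1 + Poly_Mapping.single z ?n)"
  proof (rule Sum_any_single_support)
    fix n assume "n \<noteq> ?n"
    then have "Poly_Mapping.lookup (e + Poly_Mapping.single z 1 + Poly_Mapping.single z n) z \<noteq> 0"
      by (simp add: lookup_add)
    then show "P n (e + Poly_Mapping.single z 1 + Poly_Mapping.single z n) = 0"
      using assms by blast
  qed
  also have "e + Poly_Mapping.single z 1 + Poly_Mapping.single z ?n =
      e - Poly_Mapping.single z (Poly_Mapping.lookup e z)"
    by (simp add: single_diff single_uminus algebra_simps)
  finally show ?thesis .
qed

text \<open>
  When $G$ does not involve $z$ either, the delta function only selects the power $P^n$ by which $G$
  is multiplied.
\<close>

lemma fmult_delta_quot: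
  assumes zero: "\<And>c. scale c 0 = (0::'v::comm_monoid_add)" "\<And>v. scale 0 v = (0::'v)"
    and P: "\<And>n d. P n d \<noteq> 0 \<Longrightarrow> Poly_Mapping.lookup d z = 0"
    and G: "\<And>d. G d \<noteq> 0 \<Longrightarrow> Poly_Mapping.lookup d z = 0"
  shows "fmult scale (delta_quot P z) G e =
    fmult scale (P (- Poly_Mapping.lookup e z - 1)) G
      (e - Poly_Mapping.single z (Poly_Mapping.lookup e z))"
proof -
  let ?s = "Poly_Mapping.single z (Poly_Mapping.lookup e z)"
  let ?t = "\<lambda>d. scale (delta_quot P z d) (G (e - d))"
  have surj: "d \<in> range (\<lambda>d. d + ?s)" for d :: "fvar \<Rightarrow>\<^sub>0 int"
    by (rule image_eqI[of _ _ "d - ?s"]) auto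
  have "Sum_any ?t = Sum_any (\<lambda>d. ?t (d + ?s))"
    by (rule Sum_any_reindex_support) (auto simp: surj)
  also have "\<dots> = Sum_any (\<lambda>d. scale (P (- Poly_Mapping.lookup e z - 1) d) (G (e - ?s - d)))"
  proof (rule arg_cong[where f = Sum_any], rule ext)
    fix d
    show "?t (d + ?s) = scale (P (- Poly_Mapping.lookup e z - 1) d) (G (e - ?s - d))"
    proof (cases "Poly_Mapping.lookup d z = 0")
      case True
      then show ?thesis
        by (simp add: delta_quot_apply[OF P] lookup_add diff_diff_eq add.commute)
    next
      case False
      then have "P (- Poly_Mapping.lookup e z - 1) d = 0" using P by blast
      moreover have "Poly_Mapping.lookup (e - (d + ?s)) z \<noteq> 0"
        using False by (simp add: lookup_add lookup_minus)
      then have "G (e - (d + ?s)) = 0" using G by blast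
      ultimately show ?thesis by (simp add: zero)
    qed
  qed
  finally show ?thesis by (simp add: fmult_def)
qed

lemma fmult_binom_pow:
  assumes "\<And>v. scale 0 v = (0::'v::comm_monoid_add)" and "x \<noteq> y"
  shows "fmult scale (binom_pow c x d y n) G e =
    Sum_any (\<lambda>k. scale ((of_int n gchoose k) * c powi (n - int k) * d ^ k) (G (e - binom_exp x y n k)))"
proof -
  have "Sum_any (\<lambda>e'. scale (binom_pow c x d y n e') (G (e - e'))) =
    Sum_any (\<lambda>k. scale (binom_pow c x d y n (binom_exp x y n k)) (G (e - binom_exp x y n k)))"
  proof (rule Sum_any_reindex_support)
    show "inj (binom_exp x y n)" by (simp add: inj_def binom_exp_inject assms(2))
    show "e' \<in> range (binom_exp x y n)" if "scale (binom_pow c x d y n e') (G (e - e')) \<noteq> 0" for e'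
      by (rule binom_pow_nonzeroD[of c x d y n]) (use that assms(1) in auto)
  qed
  then show ?thesis
    by (simp only: fmult_def binom_pow_binom_exp[OF assms(2)])
qed

section \<open>Exponents\<close>

definition in_vars :: "fvar set \<Rightarrow> (fvar \<Rightarrow>\<^sub>0 int) \<Rightarrow> bool" where
  "in_vars A e \<longleftrightarrow> (\<forall>z. z \<notin> A \<longrightarrow> Poly_Mapping.lookup e z = 0)"

lemma in_vars_single: "in_vars {x} e \<longleftrightarrow> e = Poly_Mapping.single x (Poly_Mapping.lookup e x)"
proof
  assume "in_vars {x} e"
  then show "e = Poly_Mapping.single x (Poly_Mapping.lookup e x)"
    by (intro poly_mapping_eqI) (auto simp: in_vars_def lookup_single when_def)
next
  assume "e = Poly_Mapping.single x (Poly_Mapping.lookup e x)"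
  then show "in_vars {x} e"
    by (metis in_vars_def lookup_single_not_eq singletonI)
qed

definition monomial_exp :: "int \<Rightarrow> int \<Rightarrow> int \<Rightarrow> (fvar \<Rightarrow>\<^sub>0 int)" where
  "monomial_exp a b c = Poly_Mapping.single X0 a + Poly_Mapping.single X1 b + Poly_Mapping.single X2 c"

lemma lookup_monomial_exp [simp]:
  "Poly_Mapping.lookup (monomial_exp a b c) X0 = a"
  "Poly_Mapping.lookup (monomial_exp a b c) X1 = b"
  "Poly_Mapping.lookup (monomial_exp a b c) X2 = c"
  by (simp_all add: monomial_exp_def lookup_add lookup_single)

text \<open>
  The coordinates $(l,m,n)$ of the coefficient of $x_0^{-l-1}x_1^{-m-1}x_2^{-n-1}$ are those in which
  the modes $u_n$ appear without shifts.
\<close>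

lemma all_exponents:
  "(\<forall>e. P e) \<longleftrightarrow> (\<forall>l m n. P (monomial_exp (- l - 1) (- m - 1) (- n - 1)))"
proof (intro iffI allI)
  fix e
  assume P: "\<forall>l m n. P (monomial_exp (- l - 1) (- m - 1) (- n - 1))"
  have "e = monomial_exp (Poly_Mapping.lookup e X0) (Poly_Mapping.lookup e X1) (Poly_Mapping.lookup e X2)"
  proof (rule poly_mapping_eqI)
    fix z show "Poly_Mapping.lookup e z = Poly_Mapping.lookup (monomial_exp (Poly_Mapping.lookup e X0)
      (Poly_Mapping.lookup e X1) (Poly_Mapping.lookup e X2)) z"
      by (cases z) simp_all
  qed
  then show "P e"
    using P[rule_format, of "- Poly_Mapping.lookup e X0 - 1" "- Poly_Mapping.lookup e X1 - 1"
        "- Poly_Mapping.lookup e X2 - 1"] by simp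
qed simp

lemma in_vars_two:
  "in_vars {X1, X2} e \<longleftrightarrow> Poly_Mapping.lookup e X0 = 0"
  "in_vars {X2, X1} e \<longleftrightarrow> Poly_Mapping.lookup e X0 = 0"
  "in_vars {X0, X2} e \<longleftrightarrow> Poly_Mapping.lookup e X1 = 0"
  "in_vars {X2, X0} e \<longleftrightarrow> Poly_Mapping.lookup e X1 = 0"
  "in_vars {X0, X1} e \<longleftrightarrow> Poly_Mapping.lookup e X2 = 0"
  "in_vars {X1, X0} e \<longleftrightarrow> Poly_Mapping.lookup e X2 = 0"
proof -
  have all: "(\<forall>z. P z) \<longleftrightarrow> P X0 \<and> P X1 \<and> P X2" for P
    by (metis fvar.exhaust)
  show "in_vars {X1, X2} e \<longleftrightarrow> Poly_Mapping.lookup e X0 = 0"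
    "in_vars {X2, X1} e \<longleftrightarrow> Poly_Mapping.lookup e X0 = 0"
    "in_vars {X0, X2} e \<longleftrightarrow> Poly_Mapping.lookup e X1 = 0"
    "in_vars {X2, X0} e \<longleftrightarrow> Poly_Mapping.lookup e X1 = 0"
    "in_vars {X0, X1} e \<longleftrightarrow> Poly_Mapping.lookup e X2 = 0"
    "in_vars {X1, X0} e \<longleftrightarrow> Poly_Mapping.lookup e X2 = 0"
    by (simp_all add: in_vars_def all)
qed

section \<open>Coefficients of nested vertex operators\<close>

locale vertex_operator_space = vector_space scale
  for scale :: "complex \<Rightarrow> 'v \<Rightarrow> 'v::ab_group_add" +
  fixes Y :: "'v \<Rightarrow> int \<Rightarrow> 'v \<Rightarrow> 'v"
  assumes Y: "vertex_operator_map scale Y"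

begin

lemma linear_imp_zero: "Vector_Spaces.linear scale scale f \<Longrightarrow> f 0 = 0"
  by (simp add: linear_iff_module_hom module_hom.zero)

lemma Y_linear_right: "Vector_Spaces.linear scale scale (Y v n)"
  and Y_linear_left: "Vector_Spaces.linear scale scale (\<lambda>v. Y v n w)"
  and Y_truncation: "\<exists>N. \<forall>n\<ge>N. Y u n v = 0"
  using Y by (simp_all add: vertex_operator_map_def)

lemma Y_zero [simp]: "Y v n 0 = 0" "Y 0 n w = 0"
  using linear_imp_zero[OF Y_linear_right] linear_imp_zero[OF Y_linear_left] by simp_all

lemma Y_scale_left: "Y (scale c v) n w = scale c (Y v n w)"
  using Y_linear_left[of n w] by (simp add: linear_iff_module_hom module_hom.scale[where f = "\<lambda>v. Y v n w"])

lemma vop_fconst_left: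
  "vop scale Y (fconst u) P F e = Sum_any (\<lambda>(n, b). scale (P (- n - 1) b) (Y u n (F (e - b))))"
proof -
  let ?t = "\<lambda>(a, n, b). scale (P (- n - 1) b) (Y (fconst u a) n (F (e - a - b)))"
  have "Sum_any ?t = Sum_any (\<lambda>p. ?t (0, p))"
  proof (rule Sum_any_reindex_support)
    fix p assume "?t p \<noteq> 0"
    then show "p \<in> range (Pair 0)"
      by (cases p) (auto simp: fconst_def when_def split: if_splits)
  qed (simp add: inj_def)
  then show ?thesis by (simp add: vop_def fconst_def split_def)
qed

lemma vop_fconst_right:
  "vop scale Y G P (fconst w) e = Sum_any (\<lambda>(a, n). scale (P (- n - 1) (e - a)) (Y (G a) n w))"
proof -
  let ?t = "\<lambda>(a, n, b). scale (P (- n - 1) b) (Y (G a) n (fconst w (e - a - b)))"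
  have "Sum_any ?t = Sum_any (\<lambda>p. ?t (case p of (a, n) \<Rightarrow> (a, n, e - a)))"
  proof (rule Sum_any_reindex_support)
    fix p assume nz: "?t p \<noteq> 0"
    obtain a n b where p: "p = (a, n, b)" by (cases p)
    with nz have "e - a - b = 0" by (auto simp: fconst_def when_def split: if_splits)
    then have "b = e - a" by simp
    then show "p \<in> range (\<lambda>p. case p of (a, n) \<Rightarrow> (a, n, e - a))"
      by (intro image_eqI[of _ _ "(a, n)"]) (simp_all add: p)
  qed (auto simp: inj_def)
  then show ?thesis by (simp add: vop_def fconst_def split_def)
qed

lemma vop_const_const:
  "vop scale Y (fconst u) (mono_pow c x) (fconst w) e =
    (if in_vars {x} e then
       scale (c powi Poly_Mapping.lookup e x) (Y u (- Poly_Mapping.lookup e x - 1) w) else 0)"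
proof -
  let ?n = "- Poly_Mapping.lookup e x - 1"
  have "vop scale Y (fconst u) (mono_pow c x) (fconst w) e =
    Sum_any (\<lambda>(n, b). scale (mono_pow c x (- n - 1) b) (Y u n (fconst w (e - b))))"
    by (rule vop_fconst_left)
  also have "\<dots> = (\<lambda>(n, b). scale (mono_pow c x (- n - 1) b) (Y u n (fconst w (e - b)))) (?n, e)"
    by (rule Sum_any_single_support)
       (auto simp: mono_pow_def fconst_def when_def split: if_splits)
  finally show ?thesis
    by (auto simp: mono_pow_def fconst_def in_vars_single)
qed

text \<open>
  The next four lemmas compute the coefficients of the four kinds of nested vertex operators. In each, the
  exponent $e$ fixes all summation indices except at most one, the index $k$ of a binomial
  expansion; they differ in whether a product or an iterate is expanded, and in whether the
  outer variable is a monomial or a binomial.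
\<close>

lemma vop_mono_mono:
  assumes "x \<noteq> y"
  shows "vop scale Y (fconst u) (mono_pow 1 x) (vop scale Y (fconst v) (mono_pow 1 y) (fconst w)) e =
    (if in_vars {x, y} e then
       Y u (- Poly_Mapping.lookup e x - 1) (Y v (- Poly_Mapping.lookup e y - 1) w) else 0)"
proof -
  let ?n = "- Poly_Mapping.lookup e x - 1"
  let ?b = "Poly_Mapping.single x (Poly_Mapping.lookup e x)"
  let ?F = "vop scale Y (fconst v) (mono_pow 1 y) (fconst w)"
  let ?t = "\<lambda>(n, b). scale (mono_pow 1 x (- n - 1) b) (Y u n (?F (e - b)))"
  have "Sum_any ?t = ?t (?n, ?b)"
  proof (rule Sum_any_single_support, rule ccontr)
    fix p assume "p \<noteq> (?n, ?b)" and nz: "?t p \<noteq> 0"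
    obtain n b where p: "p = (n, b)" by (cases p)
    from nz have b: "b = Poly_Mapping.single x (- n - 1)" and "in_vars {y} (e - b)"
      by (auto simp: p mono_pow_def vop_const_const when_def split: if_splits)
    then have "Poly_Mapping.lookup (e - b) x = 0"
      using assms by (simp add: in_vars_def)
    then have "Poly_Mapping.lookup e x = - n - 1" by (simp add: b lookup_minus)
    with b \<open>p \<noteq> _\<close> show False by (simp add: p)
  qed
  moreover have "in_vars {y} (e - ?b) \<longleftrightarrow> in_vars {x, y} e"
    using assms by (auto simp: in_vars_def lookup_minus lookup_single when_def)
  ultimately show ?thesis
    unfolding vop_fconst_left[of u _ ?F]
    using assms by (simp add: mono_pow_def vop_const_const lookup_minus lookup_single)
qed

lemma vop_binom_mono:
  assumes "x \<noteq> y"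
  shows "vop scale Y (fconst v) (binom_pow c x d y) (vop scale Y (fconst u) (mono_pow 1 y) (fconst w)) e =
    (if in_vars {x, y} e then
       Sum_any (\<lambda>k. scale ((of_int (Poly_Mapping.lookup e x + int k) gchoose k) * c powi Poly_Mapping.lookup e x * d ^ k)
         (Y v (- Poly_Mapping.lookup e x - int k - 1) (Y u (- Poly_Mapping.lookup e y + int k - 1) w))) else 0)"
proof -
  let ?ex = "Poly_Mapping.lookup e x"
  let ?g = "\<lambda>k. (- ?ex - int k - 1, binom_exp x y (?ex + int k) k)"
  let ?F = "vop scale Y (fconst u) (mono_pow 1 y) (fconst w)"
  let ?t = "\<lambda>(n, b). scale (binom_pow c x d y (- n - 1) b) (Y v n (?F (e - b)))"
  have "Sum_any ?t = Sum_any (\<lambda>k. ?t (?g k))"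
  proof (rule Sum_any_reindex_support)
    fix p assume nz: "?t p \<noteq> 0"
    obtain n b where p: "p = (n, b)" by (cases p)
    from nz have "binom_pow c x d y (- n - 1) b \<noteq> 0" and "in_vars {y} (e - b)"
      by (auto simp: p vop_const_const split: if_splits)
    then obtain k where b: "b = binom_exp x y (- n - 1) k" using binom_pow_nonzeroD by blast
    have "Poly_Mapping.lookup (e - b) x = 0"
      using \<open>in_vars {y} (e - b)\<close> assms by (simp add: in_vars_def)
    then have n: "n = - ?ex - int k - 1" by (simp add: b lookup_minus assms)
    have "p = ?g k" by (simp add: p b n)
    then show "p \<in> range ?g" by blast
  qed (simp add: inj_def)
  moreover have "in_vars {y} (e - binom_exp x y (?ex + int k) k) \<longleftrightarrow> in_vars {x, y} e" for k
    using assms by (auto simp: in_vars_def lookup_minus)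
  ultimately show ?thesis
    unfolding vop_fconst_left[of v _ ?F]
    using assms by (simp add: vop_const_const lookup_minus binom_pow_binom_exp)
qed

lemma vop_iterate_mono:
  assumes "x \<noteq> y"
  shows "vop scale Y (vop scale Y (fconst u) (mono_pow 1 x) (fconst v)) (mono_pow 1 y) (fconst w) e =
    (if in_vars {x, y} e then
       Y (Y u (- Poly_Mapping.lookup e x - 1) v) (- Poly_Mapping.lookup e y - 1) w else 0)"
proof -
  let ?n = "- Poly_Mapping.lookup e y - 1"
  let ?a = "Poly_Mapping.single x (Poly_Mapping.lookup e x)"
  let ?G = "vop scale Y (fconst u) (mono_pow 1 x) (fconst v)"
  let ?t = "\<lambda>(a, n). scale (mono_pow 1 y (- n - 1) (e - a)) (Y (?G a) n w)"
  have "Sum_any ?t = ?t (?a, ?n)"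
  proof (rule Sum_any_single_support, rule ccontr)
    fix p assume "p \<noteq> (?a, ?n)" and nz: "?t p \<noteq> 0"
    obtain a n where p: "p = (a, n)" by (cases p)
    from nz have b: "e - a = Poly_Mapping.single y (- n - 1)" and a: "in_vars {x} a"
      by (auto simp: p mono_pow_def vop_const_const when_def split: if_splits)
    from b have "Poly_Mapping.lookup (e - a) x = 0" "Poly_Mapping.lookup (e - a) y = - n - 1"
      using assms by (simp_all add: lookup_single)
    then have "Poly_Mapping.lookup a x = Poly_Mapping.lookup e x" "n = ?n"
      using assms a by (auto simp: lookup_minus in_vars_def)
    with a \<open>p \<noteq> _\<close> show False by (simp add: p in_vars_single)
  qed
  moreover have "e - ?a = Poly_Mapping.single y (Poly_Mapping.lookup e y) \<longleftrightarrow> in_vars {x, y} e"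
  proof -
    have "in_vars {y} (e - ?a) \<longleftrightarrow> in_vars {x, y} e"
      using assms by (auto simp: in_vars_def lookup_minus lookup_single when_def)
    moreover have "Poly_Mapping.lookup (e - ?a) y = Poly_Mapping.lookup e y"
      using assms by (simp add: lookup_minus lookup_single)
    ultimately show ?thesis
      unfolding in_vars_single by simp
  qed
  moreover have "in_vars {x} ?a" by (simp add: in_vars_single)
  ultimately show ?thesis
    unfolding vop_fconst_right[of ?G]
    using assms by (simp add: mono_pow_def vop_const_const when_def)
qed

text \<open>
  The inner variable may carry a sign $s$, as needed for $Y(Y(v,-x_0)u,x_2+x_0)$.
\<close>

lemma vop_iterate_binom:
  assumes "x \<noteq> y"
  shows "vop scale Y (vop scale Y (fconst u) (mono_pow s y) (fconst v)) (binom_pow c x d y) (fconst w) e =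
    (if in_vars {x, y} e then
       Sum_any (\<lambda>k. scale ((of_int (Poly_Mapping.lookup e x + int k) gchoose k) * c powi Poly_Mapping.lookup e x * d ^ k
           * s powi (Poly_Mapping.lookup e y - int k))
         (Y (Y u (- Poly_Mapping.lookup e y + int k - 1) v) (- Poly_Mapping.lookup e x - int k - 1) w)) else 0)"
proof -
  let ?ex = "Poly_Mapping.lookup e x" and ?ey = "Poly_Mapping.lookup e y"
  let ?g = "\<lambda>k. (Poly_Mapping.single y (?ey - int k), - ?ex - int k - 1)"
  let ?G = "vop scale Y (fconst u) (mono_pow s y) (fconst v)"
  let ?t = "\<lambda>(a, n). scale (binom_pow c x d y (- n - 1) (e - a)) (Y (?G a) n w)"
  have "Sum_any ?t = Sum_any (\<lambda>k. ?t (?g k))"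
  proof (rule Sum_any_reindex_support)
    fix p assume nz: "?t p \<noteq> 0"
    obtain a n where p: "p = (a, n)" by (cases p)
    from nz have "binom_pow c x d y (- n - 1) (e - a) \<noteq> 0" and a: "in_vars {y} a"
      by (auto simp: p vop_const_const split: if_splits)
    then obtain k where b: "e - a = binom_exp x y (- n - 1) k" using binom_pow_nonzeroD by blast
    have "Poly_Mapping.lookup (e - a) x = - n - 1 - int k" "Poly_Mapping.lookup (e - a) y = int k"
      using assms by (simp_all add: b)
    then have n: "n = - ?ex - int k - 1" and "Poly_Mapping.lookup a y = ?ey - int k"
      using a assms by (auto simp: in_vars_def lookup_minus)
    with a have "p = ?g k" by (simp add: p in_vars_single)
    then show "p \<in> range ?g" by blast
  qed (simp add: inj_def)
  moreover have "binom_pow c x d y (?ex + int k) (e - Poly_Mapping.single y (?ey - int k)) =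
    (if in_vars {x, y} e then (of_int (?ex + int k) gchoose k) * c powi ?ex * d ^ k else 0)" for k
  proof (cases "in_vars {x, y} e")
    case True
    then have "e - Poly_Mapping.single y (?ey - int k) = binom_exp x y (?ex + int k) k"
      using assms by (intro poly_mapping_eqI) (auto simp: in_vars_def lookup_minus lookup_single when_def)
    then show ?thesis
      using True by (simp add: binom_pow_binom_exp assms)
  next
    case False
    then obtain z where z: "z \<noteq> x" "z \<noteq> y" "Poly_Mapping.lookup e z \<noteq> 0" by (auto simp: in_vars_def)
    have "e - Poly_Mapping.single y (?ey - int k) \<noteq> binom_exp x y (?ex + int k) j" for j
    proof
      assume "e - Poly_Mapping.single y (?ey - int k) = binom_exp x y (?ex + int k) j"
      from arg_cong[OF this, of "\<lambda>e. Poly_Mapping.lookup e z"] show False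
        using z assms by (simp add: lookup_minus lookup_single)
    qed
    then show ?thesis
      using False binom_pow_nonzeroD[of c x d y "?ex + int k"] by auto
  qed
  moreover have "in_vars {y} (Poly_Mapping.single y n)" for n by (simp add: in_vars_single)
  ultimately show ?thesis
    unfolding vop_fconst_right[of ?G]
    using assms by (auto simp add: vop_const_const Y_scale_left)
qed

section \<open>Binomial sums\<close>

lemma Sum_any_scale_right:
  assumes "c \<noteq> 0"
  shows "Sum_any (\<lambda>k. scale c (f k)) = scale c (Sum_any f)"
proof -
  have "{k. scale c (f k) \<noteq> 0} = {k. f k \<noteq> 0}" using assms by simp
  then show ?thesis by (simp add: Sum_any.expand_set scale_sum_right)
qed

definition binsum :: "int \<Rightarrow> (nat \<Rightarrow> 'v) \<Rightarrow> 'v" where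
  "binsum l f = Sum_any (\<lambda>k. scale (of_int l gchoose k) (f k))"

lemma binsum_bounded:
  assumes "\<And>k. k \<ge> K \<Longrightarrow> f k = 0"
  shows "binsum l f = (\<Sum>k<K. scale (of_int l gchoose k) (f k))"
  unfolding binsum_def
  by (rule Sum_any.expand_superset) (use assms in \<open>auto simp: not_le[symmetric]\<close>)

lemma binsum_zero [simp]: "binsum 0 f = f 0"
proof -
  have "(0 gchoose k :: complex) = 0" if "k \<noteq> 0" for k
    using that by (cases k) simp_all
  then show ?thesis
    unfolding binsum_def by (subst Sum_any_single_support[of 0]) auto
qed

text \<open>
  Pascal's rule. Finiteness of the support of $f$ is essential, because \<open>Sum_any\<close> is additive only on
  finitely supported families.
\<close>

lemma binsum_Suc:
  assumes "\<And>k. k \<ge> K \<Longrightarrow> f k = 0"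
  shows "binsum (l + 1) f = binsum l f + binsum l (\<lambda>k. f (Suc k))"
proof -
  have "binsum (l + 1) f = (\<Sum>k<Suc K. scale (of_int (l + 1) gchoose k) (f k))"
    by (rule binsum_bounded) (simp add: assms)
  also have "\<dots> = f 0 + (\<Sum>k<K. scale (of_int l gchoose Suc k) (f (Suc k)))
      + (\<Sum>k<K. scale (of_int l gchoose k) (f (Suc k)))"
    by (simp add: sum.lessThan_Suc_shift gbinomial_Suc_Suc scale_left_distrib sum.distrib
      del: sum.lessThan_Suc)
  also have "f 0 + (\<Sum>k<K. scale (of_int l gchoose Suc k) (f (Suc k))) =
      (\<Sum>k<Suc K. scale (of_int l gchoose k) (f k))"
    by (simp add: sum.lessThan_Suc_shift del: sum.lessThan_Suc)
  also have "\<dots> = binsum l f"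
    by (rule binsum_bounded[symmetric]) (simp add: assms)
  also have "(\<Sum>k<K. scale (of_int l gchoose k) (f (Suc k))) = binsum l (\<lambda>k. f (Suc k))"
    by (rule binsum_bounded[symmetric]) (simp add: assms)
  finally show ?thesis .
qed

lemma binsum_nat_cong:
  assumes "\<And>k. k \<le> M \<Longrightarrow> f k = g k"
  shows "binsum (int M) f = binsum (int M) g"
proof -
  have "scale (of_int (int M) gchoose k) (f k) = scale (of_int (int M) gchoose k) (g k)" for k
    using assms[of k] by (cases "k \<le> M") (simp_all add: binomial_gbinomial[symmetric])
  then show ?thesis by (simp only: binsum_def)
qed

text \<open>
  For a natural upper index the binomial coefficients cut the sum off, so Pascal's rule holds for
  arbitrary $f$. This is needed for families $f$ with infinite support, which arise when a
  series is multiplied by $(x_1-x_0)^M$.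
\<close>

lemma binsum_nat_Suc: "binsum (int (Suc M)) f = binsum (int M) f + binsum (int M) (\<lambda>k. f (Suc k))"
proof -
  \<comment> \<open>truncated so that the finite-support version of Pascal's rule applies\<close>
  define g where "g k = (if k \<le> Suc M then f k else 0)" for k
  have "binsum (int (Suc M)) f = binsum (int (Suc M)) g"
    by (rule binsum_nat_cong) (simp add: g_def)
  also have "\<dots> = binsum (int M + 1) g"
    by (simp add: add.commute)
  also have "binsum (int M + 1) g = binsum (int M) g + binsum (int M) (\<lambda>k. g (Suc k))"
    by (rule binsum_Suc[of "Suc (Suc M)"]) (simp add: g_def)
  also have "binsum (int M) g = binsum (int M) f"
    by (rule binsum_nat_cong) (simp add: g_def)
  also have "binsum (int M) (\<lambda>k. g (Suc k)) = binsum (int M) (\<lambda>k. f (Suc k))"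
    by (rule binsum_nat_cong) (simp add: g_def)
  finally show ?thesis .
qed

lemma binsum_uminus: "binsum l (\<lambda>k. - f k) = - binsum l f"
  using Sum_any_scale_right[of "-1" "\<lambda>k. scale (of_int l gchoose k) (f k)"]
  by (simp add: binsum_def)

section \<open>The triangular recursion\<close>

text \<open>
  The recursion expresses that $x_0$ acts as $x_1-x_2$ under the delta functions: multiplication by a
  variable shifts the corresponding index by one.
\<close>

definition triangular :: "(int \<Rightarrow> int \<Rightarrow> int \<Rightarrow> 'v) \<Rightarrow> bool" where
  "triangular F \<longleftrightarrow> (\<forall>l m n. F (l + 1) m n = F l (m + 1) n - F l m (n + 1))"

text \<open>
  The effect on coefficients of interchanging $x_1$ and $x_2$ and replacing $x_0$ by $-x_0$, up to
  an overall sign.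
\<close>

definition swap :: "(int \<Rightarrow> int \<Rightarrow> int \<Rightarrow> 'v) \<Rightarrow> int \<Rightarrow> int \<Rightarrow> int \<Rightarrow> 'v" where
  "swap F l m n = scale ((-1) powi l) (F l n m)"

text \<open>
  Coefficients of $x_0^{-1}\delta((x_1-x_2)/x_0)\,Y(u,x_1)Y(v,x_2)w$.
\<close>

definition product_coeff :: "'v \<Rightarrow> 'v \<Rightarrow> 'v \<Rightarrow> int \<Rightarrow> int \<Rightarrow> int \<Rightarrow> 'v" where
  "product_coeff u v w l m n =
    binsum l (\<lambda>k. scale ((-1) ^ k) (Y u (m + l - int k) (Y v (n + int k) w)))"

text \<open>
  Coefficients of $x_1^{-1}\delta((x_2+x_0)/x_1)\,Y(Y(u,x_0)v,x_2)w$.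
\<close>

definition iterate_coeff :: "'v \<Rightarrow> 'v \<Rightarrow> 'v \<Rightarrow> int \<Rightarrow> int \<Rightarrow> int \<Rightarrow> 'v" where
  "iterate_coeff u v w l m n = binsum m (\<lambda>k. Y (Y u (l + int k) v) (m + n - int k) w)"

text \<open>
  The part of the Jacobi identity that survives when $n$ is so large that $v_{n+k}w=0$ for all
  $k\ge0$; at $n=0$ it is, up to sign, the difference in weak skew-associativity.
\<close>

definition skew_defect :: "'v \<Rightarrow> 'v \<Rightarrow> 'v \<Rightarrow> int \<Rightarrow> int \<Rightarrow> int \<Rightarrow> 'v" where
  "skew_defect u v w l m n = swap (product_coeff v u w) l m n + iterate_coeff u v w l m n"

definition jacobi_defect :: "'v \<Rightarrow> 'v \<Rightarrow> 'v \<Rightarrow> int \<Rightarrow> int \<Rightarrow> int \<Rightarrow> 'v" where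
  "jacobi_defect u v w l m n = product_coeff u v w l m n - skew_defect u v w l m n"

lemma triangularD: "triangular F \<Longrightarrow> F (l + 1) m n = F l (m + 1) n - F l m (n + 1)"
  by (simp add: triangular_def)

lemma swap_swap [simp]: "swap (swap F) l m n = F l m n"
  by (simp add: swap_def minus_one_powi_square)

lemma triangular_swap: "triangular F \<Longrightarrow> triangular (swap F)"
  by (simp add: triangular_def swap_def power_int_add scale_right_diff_distrib)

lemma triangular_add: "triangular F \<Longrightarrow> triangular G \<Longrightarrow> triangular (\<lambda>l m n. F l m n + G l m n)"
  by (simp add: triangular_def)

lemma triangular_diff: "triangular F \<Longrightarrow> triangular G \<Longrightarrow> triangular (\<lambda>l m n. F l m n - G l m n)"
  by (simp add: triangular_def)

lemma triangular_product_coeff: "triangular (product_coeff u v w)"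
  unfolding triangular_def
proof (intro allI)
  fix l m n
  obtain N where N: "\<And>i. i \<ge> N \<Longrightarrow> Y v i w = 0" using Y_truncation by blast
  let ?f = "\<lambda>k. scale ((-1) ^ k) (Y u (m + (l + 1) - int k) (Y v (n + int k) w))"
  have "product_coeff u v w (l + 1) m n = binsum l ?f + binsum l (\<lambda>k. ?f (Suc k))"
    unfolding product_coeff_def by (rule binsum_Suc[of "nat (N - n)"]) (simp add: N)
  also have "binsum l (\<lambda>k. ?f (Suc k)) = - product_coeff u v w l m (n + 1)"
    by (simp add: product_coeff_def binsum_uminus algebra_simps)
  also have "binsum l ?f = product_coeff u v w l (m + 1) n"
    by (simp add: product_coeff_def algebra_simps)
  finally show "product_coeff u v w (l + 1) m n =
    product_coeff u v w l (m + 1) n - product_coeff u v w l m (n + 1)" by simp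
qed

lemma triangular_iterate_coeff: "triangular (iterate_coeff u v w)"
  unfolding triangular_def
proof (intro allI)
  fix l m n
  obtain N where N: "\<And>i. i \<ge> N \<Longrightarrow> Y u i v = 0" using Y_truncation by blast
  let ?f = "\<lambda>k. Y (Y u (l + int k) v) (m + 1 + n - int k) w"
  have "iterate_coeff u v w l (m + 1) n = binsum m ?f + binsum m (\<lambda>k. ?f (Suc k))"
    unfolding iterate_coeff_def by (rule binsum_Suc[of "nat (N - l)"]) (simp add: N)
  also have "binsum m (\<lambda>k. ?f (Suc k)) = iterate_coeff u v w (l + 1) m n"
    by (simp add: iterate_coeff_def algebra_simps)
  also have "binsum m ?f = iterate_coeff u v w l m (n + 1)"
    by (simp add: iterate_coeff_def algebra_simps)
  finally show "iterate_coeff u v w (l + 1) m n =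
    iterate_coeff u v w l (m + 1) n - iterate_coeff u v w l m (n + 1)" by simp
qed

lemma triangular_skew_defect: "triangular (skew_defect u v w)"
  unfolding skew_defect_def
  by (intro triangular_add triangular_swap triangular_product_coeff triangular_iterate_coeff)

lemma triangular_jacobi_defect: "triangular (jacobi_defect u v w)"
  unfolding jacobi_defect_def
  by (intro triangular_diff triangular_product_coeff triangular_skew_defect)

text \<open>
  The left side is a coefficient of $(x_1-x_0)^M$ times a series with coefficients $F(l,m,n)$, $n$ fixed.
  Since $x_1-x_0$ plays the role of $x_2$, the product is a shift of $n$ by $M$.
\<close>

lemma triangular_binsum:
  assumes F: "triangular F"
  shows "binsum (int M) (\<lambda>k. scale ((-1) ^ k) (F (l + int k) (m + int M - int k) n)) = F l m (n + int M)"
proof (induction M arbitrary: l m)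
  case (Suc M)
  have "binsum (int (Suc M)) (\<lambda>k. scale ((-1) ^ k) (F (l + int k) (m + int (Suc M) - int k) n)) =
    binsum (int M) (\<lambda>k. scale ((-1) ^ k) (F (l + int k) (m + 1 + int M - int k) n)) -
    binsum (int M) (\<lambda>k. scale ((-1) ^ k) (F (l + 1 + int k) (m + int M - int k) n))"
    by (subst binsum_nat_Suc) (simp add: binsum_uminus algebra_simps)
  also have "\<dots> = F l (m + 1) (n + int M) - F (l + 1) m (n + int M)"
    by (simp only: Suc.IH)
  also have "\<dots> = F l m (n + int (Suc M))"
    using triangularD[OF F, of l m "n + int M"] by (simp add: algebra_simps)
  finally show ?case .
qed simp

section \<open>Propagation of zeros\<close>

lemma product_coeff_eventually_zero: "\<exists>N. \<forall>n\<ge>N. \<forall>l m. product_coeff u v w l m n = 0"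
proof -
  obtain N where "\<And>i. i \<ge> N \<Longrightarrow> Y v i w = 0" using Y_truncation by blast
  then have "\<forall>n\<ge>N. \<forall>l m. product_coeff u v w l m n = 0"
    by (simp add: product_coeff_def binsum_def)
  then show ?thesis ..
qed

text \<open>
  Solve the recursion for $F(l,m,n+1)$.
\<close>

lemma triangular_zero_upward:
  assumes F: "triangular F" and "\<And>l m. F l m N = 0" and "n \<ge> N"
  shows "F l m n = 0"
proof -
  have "\<forall>l m. F l m n = 0"
    using \<open>n \<ge> N\<close>
  proof (induction n rule: int_ge_induct)
    case base
    then show ?case by (simp add: assms(2))
  next
    case (step i)
    have "F l m (i + 1) = F l (m + 1) i - F (l + 1) m i" for l m
      using triangularD[OF F, of l m i] by simp
    then show ?case using step by simp
  qed
  then show ?thesis by blast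
qed

text \<open>
  If $m+n\ge M+N$ then $m\ge M$ or $n\ge N$, so $F$ vanishes there. The recursion writes
  $F(l,m,n)$ as a difference of values with $m+n$ one larger and $l$ one smaller; as nothing
  restricts $l$, one descends on $m+n$ through all of the lattice.
\<close>

lemma triangular_zero:
  assumes F: "triangular F"
    and m: "\<And>l m n. m \<ge> M \<Longrightarrow> F l m n = 0" and n: "\<And>l m n. n \<ge> N \<Longrightarrow> F l m n = 0"
  shows "F l m n = 0"
proof -
  have "\<forall>l m n. m + n \<ge> M + N - int i \<longrightarrow> F l m n = 0" for i
  proof (induction i)
    case 0
    have "m \<ge> M \<or> n \<ge> N" if "m + n \<ge> M + N" for m n :: int
      using that by linarith
    then show ?case using m n by (metis diff_zero of_nat_0)
  next
    case (Suc i)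
    show ?case
    proof (intro allI impI)
      fix l m n assume "m + n \<ge> M + N - int (Suc i)"
      then have "F (l - 1) (m + 1) n = 0" "F (l - 1) m (n + 1) = 0"
        using Suc.IH by simp_all
      then show "F l m n = 0"
        using triangularD[OF F, of "l - 1" m n] by simp
    qed
  qed
  from this[of "nat (M + N - m - n)"] show ?thesis by simp
qed

lemma iterate_coeff_zero: "iterate_coeff u v w l 0 n = Y (Y u l v) n w"
  by (simp add: iterate_coeff_def)

text \<open>
  Skew-symmetry concerns the plane $m=0$ only. The difference $E$ of the two sides satisfies the triangular
  recursion, so it vanishes for positive $m$ at once. For negative $m$ the recursion reduces to
  $E(l+1,m,n)=-E(l,m,n+1)$ once the plane $m+1$ is known to vanish, and there the truncation
  $u_iv=v_iu=0$ for large $i$ supplies the starting point: $E=0$ for large $l$.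
\<close>

lemma iterate_skew:
  assumes "\<And>q n. iterate_coeff u v w q 0 n = - swap (iterate_coeff v u w) q 0 n"
  shows "iterate_coeff u v w l m n = - swap (iterate_coeff v u w) l m n"
proof -
  define E where "E l m n = iterate_coeff u v w l m n + swap (iterate_coeff v u w) l m n" for l m n
  have E: "triangular E"
    unfolding E_def by (intro triangular_add triangular_swap triangular_iterate_coeff)
  have zero: "E l 0 n = 0" for l n by (simp add: E_def assms)
  obtain N1 N2 where N: "\<And>i. i \<ge> N1 \<Longrightarrow> Y u i v = 0" "\<And>i. i \<ge> N2 \<Longrightarrow> Y v i u = 0"
    using Y_truncation by metis
  have large: "E l m n = 0" if "l \<ge> max N1 N2" for l m n
    using that N by (simp add: E_def swap_def iterate_coeff_def binsum_def)
  have "\<forall>l n. E l m n = 0"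
  proof (induction m rule: int_induct[where k = 0])
    case base
    show ?case by (simp add: zero)
  next
    case (step1 i)
    have "E l (i + 1) n = E (l + 1) i n + E l i (n + 1)" for l n
      using triangularD[OF E, of l i n] by simp
    then show ?case using step1 by simp
  next
    case (step2 i)
    have step: "E (l + 1) (i - 1) n = - E l (i - 1) (n + 1)" for l n
      using triangularD[OF E, of l "i - 1" n] step2 by simp
    have down: "\<forall>l n. l \<ge> max N1 N2 - int j \<longrightarrow> E l (i - 1) n = 0" for j
    proof (induction j)
      case 0
      then show ?case by (simp add: large)
    next
      case (Suc j)
      show ?case
      proof (intro allI impI)
        fix l n assume "l \<ge> max N1 N2 - int (Suc j)"
        then have "E (l + 1) (i - 1) (n - 1) = 0" using Suc.IH by simp
        then show "E l (i - 1) n = 0" using step[of l "n - 1"] by simp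
      qed
    qed
    show ?case
    proof (intro allI)
      fix l n
      have "l \<ge> max N1 N2 - int (nat (max N1 N2 - l))" by linarith
      with down show "E l (i - 1) n = 0" by blast
    qed
  qed
  then show ?thesis by (simp add: E_def eq_neg_iff_add_eq_0)
qed

text \<open>
  In terms of coefficients both directions are short. If the Jacobi identity holds, truncation removes
  the product term for large $n$, leaving weak skew-associativity, and adding the identity for $(u,v)$ to the
  swapped one for $(v,u)$ cancels all products, leaving skew-symmetry.
  Conversely, weak skew-associativity makes the Jacobi defect vanish for large $n$; by
  skew-symmetry the defects of $(u,v)$ and $(v,u)$ are swapped negatives of each other, so it also
  vanishes for large $m$, and \<open>triangular_zero\<close> applies.
\<close>

lemma jacobi_iff_skew:
  "(\<forall>u v w l m n. jacobi_defect u v w l m n = 0) \<longleftrightarrow>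
    (\<forall>u v w. \<exists>N::nat. \<forall>l m. skew_defect u v w l m (int N) = 0) \<and>
    (\<forall>u v w q n. iterate_coeff u v w q 0 n = - swap (iterate_coeff v u w) q 0 n)"
  (is "?J \<longleftrightarrow> ?A \<and> ?S")
proof (intro iffI conjI allI)
  fix u v w
  assume J: ?J
  obtain N where N: "\<And>n l m. n \<ge> N \<Longrightarrow> product_coeff u v w l m n = 0"
    using product_coeff_eventually_zero by blast
  have "skew_defect u v w l m (int (nat N)) = 0" for l m
    using J N[of "int (nat N)" l m] by (simp add: jacobi_defect_def)
  then show "\<exists>N::nat. \<forall>l m. skew_defect u v w l m (int N) = 0" by blast
next
  fix u v w q n
  assume J: ?J
  have "jacobi_defect u v w q 0 n + swap (jacobi_defect v u w) q 0 n = 0"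
    using J by (simp add: swap_def)
  then have "- iterate_coeff u v w q 0 n = swap (iterate_coeff v u w) q 0 n"
    by (simp add: jacobi_defect_def skew_defect_def swap_def scale_right_diff_distrib
      scale_right_distrib minus_one_powi_square add_eq_0_iff2)
  then show "iterate_coeff u v w q 0 n = - swap (iterate_coeff v u w) q 0 n"
    by (metis minus_minus)
next
  fix u v w l m n
  assume "?A \<and> ?S"
  then have A: ?A and S: ?S by blast+
  have large: "\<exists>N. \<forall>n\<ge>N. \<forall>l m. jacobi_defect u v w l m n = 0" for u v w
  proof -
    obtain N1 where N1: "\<And>l m. skew_defect u v w l m (int N1) = 0" using A by blast
    obtain N2 where N2: "\<And>n l m. n \<ge> N2 \<Longrightarrow> product_coeff u v w l m n = 0"
      using product_coeff_eventually_zero by blast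
    have "jacobi_defect u v w l m n = 0" if "n \<ge> max (int N1) N2" for l m n
      using that N2 triangular_zero_upward[OF triangular_skew_defect N1, of n]
      by (simp add: jacobi_defect_def)
    then show ?thesis by blast
  qed
  obtain N where N: "\<And>n l m. n \<ge> N \<Longrightarrow> jacobi_defect u v w l m n = 0" using large by blast
  obtain M where M: "\<And>n l m. n \<ge> M \<Longrightarrow> jacobi_defect v u w l m n = 0" using large by blast
  have swap: "jacobi_defect u v w l m n = - swap (jacobi_defect v u w) l m n" for l m n
    using iterate_skew[of u v w l m n] S
    by (simp add: jacobi_defect_def skew_defect_def swap_def scale_right_diff_distrib
      scale_right_distrib minus_one_powi_square)
  show "jacobi_defect u v w l m n = 0"
  proof (rule triangular_zero[OF triangular_jacobi_defect])
    show "jacobi_defect u v w l m n = 0" if "m \<ge> M" for l m n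
      using that M by (subst swap) (simp add: swap_def)
  qed (rule N)
qed

section \<open>The identities in terms of coefficients\<close>

lemma fmult_delta_binom:
  assumes "x \<noteq> z" "y \<noteq> z" "x \<noteq> y" and G: "\<And>d. G d \<noteq> 0 \<Longrightarrow> Poly_Mapping.lookup d z = 0"
  shows "fmult scale (delta_quot (binom_pow c x d y) z) G e =
    Sum_any (\<lambda>k. scale ((of_int (- Poly_Mapping.lookup e z - 1) gchoose k)
        * c powi (- Poly_Mapping.lookup e z - 1 - int k) * d ^ k)
      (G (e - Poly_Mapping.single z (Poly_Mapping.lookup e z) - binom_exp x y (- Poly_Mapping.lookup e z - 1) k)))"
proof -
  have P: "Poly_Mapping.lookup e' z = 0" if "binom_pow c x d y n e' \<noteq> 0" for n e'
    using binom_pow_nonzeroD[OF that] assms(1-3) by auto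
  have "fmult scale (delta_quot (binom_pow c x d y) z) G e =
      fmult scale (binom_pow c x d y (- Poly_Mapping.lookup e z - 1)) G
        (e - Poly_Mapping.single z (Poly_Mapping.lookup e z))"
    by (rule fmult_delta_quot[OF _ _ P G]) simp_all
  then show ?thesis
    by (simp only: fmult_binom_pow[where scale = scale, OF scale_zero_left \<open>x \<noteq> y\<close>])
qed

lemma jacobi_product_term:
  "fmult scale (delta_quot (binom_pow 1 X1 (-1) X2) X0)
     (vop scale Y (fconst u) (mono_pow 1 X1) (vop scale Y (fconst v) (mono_pow 1 X2) (fconst w)))
     (monomial_exp (- l - 1) (- m - 1) (- n - 1)) =
   product_coeff u v w l m n"
  by (subst fmult_delta_binom)
     (simp_all add: vop_mono_mono in_vars_two product_coeff_def binsum_def lookup_minus lookup_single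
       split: if_splits, simp_all add: algebra_simps)

lemma jacobi_swapped_term:
  "fmult scale (delta_quot (binom_pow (-1) X2 1 X1) X0)
     (vop scale Y (fconst v) (mono_pow 1 X2) (vop scale Y (fconst u) (mono_pow 1 X1) (fconst w)))
     (monomial_exp (- l - 1) (- m - 1) (- n - 1)) =
   swap (product_coeff v u w) l m n"
  unfolding swap_def product_coeff_def binsum_def
  by (subst Sum_any_scale_right[symmetric], simp, subst fmult_delta_binom)
     (simp_all add: vop_mono_mono in_vars_two minus_one_powi_diff lookup_minus lookup_single
       split: if_splits, simp_all add: algebra_simps)

lemma jacobi_iterate_term:
  "fmult scale (delta_quot (binom_pow 1 X2 1 X0) X1)
     (vop scale Y (vop scale Y (fconst u) (mono_pow 1 X0) (fconst v)) (mono_pow 1 X2) (fconst w))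
     (monomial_exp (- l - 1) (- m - 1) (- n - 1)) =
   iterate_coeff u v w l m n"
  by (subst fmult_delta_binom)
     (simp_all add: vop_iterate_mono in_vars_two iterate_coeff_def binsum_def lookup_minus lookup_single
       split: if_splits, simp_all add: algebra_simps)

lemma jacobi_identity_iff:
  "jacobi_identity scale Y u v \<longleftrightarrow> (\<forall>w l m n. jacobi_defect u v w l m n = 0)"
  unfolding jacobi_identity_def fun_eq_iff
  by (subst all_exponents)
     (simp add: jacobi_product_term jacobi_swapped_term jacobi_iterate_term
       jacobi_defect_def skew_defect_def algebra_simps)

text \<open>
  Both expansions carry binomial coefficients with upper index $-l-1+k$ or $-m-1+k$; negating the
  upper index turns them into those of the Jacobi identity at $n=0$.
\<close>

lemma skew_associator:
  "vop scale Y (fconst v) (binom_pow (-1) X0 1 X1) (vop scale Y (fconst u) (mono_pow 1 X1) (fconst w))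
     (monomial_exp (- l - 1) (- m - 1) c)
   - vop scale Y (vop scale Y (fconst u) (mono_pow 1 X0) (fconst v)) (binom_pow 1 X1 (-1) X0) (fconst w)
     (monomial_exp (- l - 1) (- m - 1) c) =
   (if c = 0 then - skew_defect u v w l m 0 else 0)"
proof -
  have "vop scale Y (fconst v) (binom_pow (-1) X0 1 X1) (vop scale Y (fconst u) (mono_pow 1 X1) (fconst w))
      (monomial_exp (- l - 1) (- m - 1) c) =
    (if c = 0 then scale (- ((-1) powi l)) (product_coeff v u w l 0 m) else 0)"
    unfolding product_coeff_def binsum_def
    by (subst Sum_any_scale_right[symmetric], simp, subst vop_binom_mono)
       (simp_all add: in_vars_two gchoose_negated_upper minus_one_powi_reflect del: of_int_add of_int_diff,
        simp_all add: algebra_simps)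
  moreover have "vop scale Y (vop scale Y (fconst u) (mono_pow 1 X0) (fconst v)) (binom_pow 1 X1 (-1) X0) (fconst w)
      (monomial_exp (- l - 1) (- m - 1) c) =
    (if c = 0 then iterate_coeff u v w l m 0 else 0)"
    unfolding iterate_coeff_def binsum_def
    by (subst vop_iterate_binom)
       (simp_all add: in_vars_two gchoose_negated_upper del: of_int_add of_int_diff,
        simp_all add: algebra_simps)
  ultimately show ?thesis by (simp add: skew_defect_def swap_def)
qed

lemma weak_skew_associativity_iff:
  "weak_skew_associativity scale Y u v w \<longleftrightarrow> (\<exists>N::nat. \<forall>l m. skew_defect u v w l m (int N) = 0)"
proof -
  let ?C = "\<lambda>e. vop scale Y (fconst v) (binom_pow (-1) X0 1 X1)
              (vop scale Y (fconst u) (mono_pow 1 X1) (fconst w)) e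
          - vop scale Y (vop scale Y (fconst u) (mono_pow 1 X0) (fconst v))
              (binom_pow 1 X1 (-1) X0) (fconst w) e"
  \<comment> \<open>the exponent $-n-1$ of $x_2$ is 0 exactly for $n=-1$\<close>
  have coeff: "fmult scale (binom_pow 1 X1 (-1) X0 (int N)) ?C (monomial_exp (- l - 1) (- m - 1) (- n - 1)) =
      (if n = - 1 then - skew_defect u v w l m (int N) else 0)" for N l m n
  proof -
    have shift: "monomial_exp (- l - 1) (- m - 1) (- n - 1) - binom_exp X1 X0 (int N) k =
        monomial_exp (- (l + int k) - 1) (- (m + int N - int k) - 1) (- n - 1)" for k
    proof (rule poly_mapping_eqI)
      fix z show "Poly_Mapping.lookup (monomial_exp (- l - 1) (- m - 1) (- n - 1) - binom_exp X1 X0 (int N) k) z =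
          Poly_Mapping.lookup (monomial_exp (- (l + int k) - 1) (- (m + int N - int k) - 1) (- n - 1)) z"
        by (cases z) (simp_all add: lookup_minus)
    qed
    have "fmult scale (binom_pow 1 X1 (-1) X0 (int N)) ?C (monomial_exp (- l - 1) (- m - 1) (- n - 1)) =
      Sum_any (\<lambda>k. scale ((of_int (int N) gchoose k) * 1 powi (int N - int k) * (- 1) ^ k)
        (if - n - 1 = 0 then - skew_defect u v w (l + int k) (m + int N - int k) 0 else 0))"
      by (simp only: fmult_binom_pow[where scale = scale, OF scale_zero_left fvar.distinct(2)] shift skew_associator)
    also have "\<dots> = (if n = - 1 then
        - binsum (int N) (\<lambda>k. scale ((-1) ^ k) (skew_defect u v w (l + int k) (m + int N - int k) 0)) else 0)"
      by (simp add: binsum_uminus[symmetric]) (simp add: binsum_def)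
    also have "\<dots> = (if n = - 1 then - skew_defect u v w l m (int N) else 0)"
      by (simp only: triangular_binsum[OF triangular_skew_defect] add_0)
    finally show ?thesis .
  qed
  have nat: "(\<exists>m::int. m \<ge> 0 \<and> P m) \<longleftrightarrow> (\<exists>N::nat. P (int N))" for P
    using zero_le_imp_eq_int by (auto intro: exI[of _ "int _"])
  have "weak_skew_associativity scale Y u v w \<longleftrightarrow>
      (\<exists>N::nat. fmult scale (binom_pow 1 X1 (-1) X0 (int N)) ?C = (\<lambda>e. 0))"
    unfolding weak_skew_associativity_def by (rule nat)
  also have "\<dots> \<longleftrightarrow> (\<exists>N::nat. \<forall>l m. skew_defect u v w l m (int N) = 0)"
    unfolding fun_eq_iff by (subst all_exponents) (auto simp: coeff)
  finally show ?thesis .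
qed

text \<open>
  Neither side involves $x_1$, so only exponents with $m=-1$ contribute. The coefficient
  sequences are evaluated at $m=0$ instead, where $R_{u,v}(q,0,n)=(u_qv)_nw$ is a single term.
\<close>

lemma vacuum_free_skew_symmetry_iff:
  "vacuum_free_skew_symmetry scale Y u v \<longleftrightarrow>
    (\<forall>w q n. iterate_coeff u v w q 0 n = - swap (iterate_coeff v u w) q 0 n)"
proof -
  have left: "vop scale Y (vop scale Y (fconst u) (mono_pow 1 X0) (fconst v)) (mono_pow 1 X2) (fconst w)
      (monomial_exp (- q - 1) (- m - 1) (- n - 1)) =
    (if m = - 1 then iterate_coeff u v w q 0 n else 0)" for w q m n
    by (auto simp: vop_iterate_mono in_vars_two iterate_coeff_zero)
  have right: "vop scale Y (vop scale Y (fconst v) (mono_pow (-1) X0) (fconst u)) (binom_pow 1 X2 1 X0) (fconst w)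
      (monomial_exp (- q - 1) (- m - 1) (- n - 1)) =
    (if m = - 1 then - swap (iterate_coeff v u w) q 0 n else 0)" for w q m n
  proof -
    have "- swap (iterate_coeff v u w) q 0 n = scale (- ((-1) powi q)) (iterate_coeff v u w q n 0)"
      by (simp add: swap_def)
    also have "\<dots> = Sum_any (\<lambda>k. scale (- ((-1) powi q)) (scale (of_int n gchoose k) (Y (Y v (q + int k) u) (n + 0 - int k) w)))"
      unfolding iterate_coeff_def binsum_def by (subst Sum_any_scale_right) simp_all
    finally have swap: "- swap (iterate_coeff v u w) q 0 n = \<dots>" .
    show ?thesis
      unfolding swap
      by (subst vop_iterate_binom)
         (auto simp: in_vars_two gchoose_negated_upper minus_one_powi_diff minus_one_powi_reflect
           simp del: of_int_add of_int_diff, simp_all add: algebra_simps)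
  qed
  show ?thesis
    unfolding vacuum_free_skew_symmetry_def fun_eq_iff
    by (subst all_exponents) (auto simp: left right)
qed

end

theorem proposition4p5:
  fixes scale :: "complex \<Rightarrow> 'v \<Rightarrow> 'v::ab_group_add"
    and Y :: "'v \<Rightarrow> int \<Rightarrow> 'v \<Rightarrow> 'v"
  assumes "vector_space scale"
    and "vertex_operator_map scale Y"
  shows "(\<forall>u v. jacobi_identity scale Y u v) \<longleftrightarrow>
    (\<forall>u v w. weak_skew_associativity scale Y u v w) \<and>
    (\<forall>u v. vacuum_free_skew_symmetry scale Y u v)"
proof -
  interpret vertex_operator_space scale Y
    using assms by (simp add: vertex_operator_space_def vertex_operator_space_axioms_def)
  show ?thesis
    unfolding jacobi_identity_iff weak_skew_associativity_iff vacuum_free_skew_symmetry_iff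
    by (rule jacobi_iff_skew)
qed

end
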